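(* Let $q$ be a positive real algebraic number. The weight $w_q$ is unique in each of the following two cases: (i) for some $\sigma\in\mathrm{Gal}(\overline{\mathbb Q}/\mathbb Q)$ the conjugate $q^\sigma$ is real and satisfies $q^\sigma\ge4$; (ii) $q$ is a totally positive algebraic integer.
   Context: Let $q>0$. For an integer $k\ge0$ and $\mathbf m=(m_0,\dots,m_k)\in\mathbb Z^{k+1}$ put $\mathbf m_j=(m_0,\dots,m_j)$. Define $c(q,\mathbf m_0)=m_0$ and recursively $c(q,\mathbf m_j)=m_j+\frac{1}{q\,c(q,\mathbf m_{j-1})}$ for $1\le j\le k$. The vector $\mathbf m$ is a path for $q$ (of length $k$) if $c(q,\mathbf m_j)\ne0$ for $0\le j\le k-1$. The weight of a path is $w_q(\mathbf m)=q^{k/2}\prod_{j=0}^{k-1}|c(q,\mathbf m_j)|$ (and $w_q(\mathbf m)=1$ if $k=0$). The weight $w_q$ is called unique if $w_q(\mathbf m)=w_q(\mathbf n)$ for all paths $\mathbf m,\mathbf n$ for $q$ with $c(q,\mathbf m)=c(q,\mathbf n)$. *)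

theory Defs
  imports "HOL-Analysis.Analysis" "HOL-Computational_Algebra.Polynomial_Factorial"
begin

fun cval :: "real \<Rightarrow> (nat \<Rightarrow> int) \<Rightarrow> nat \<Rightarrow> real" where
  "cval q m 0 = of_int (m 0)"
| "cval q m (Suc j) = of_int (m (Suc j)) + 1 / (q * cval q m j)"

definition is_path :: "real \<Rightarrow> nat \<Rightarrow> (nat \<Rightarrow> int) \<Rightarrow> bool" where
  "is_path q k m \<longleftrightarrow> (\<forall>j<k. cval q m j \<noteq> 0)"

definition weight :: "real \<Rightarrow> nat \<Rightarrow> (nat \<Rightarrow> int) \<Rightarrow> real" where
  "weight q k m = q powr (real k / 2) * (\<Prod>j<k. \<bar>cval q m j\<bar>)"

definition unique_weight :: "real \<Rightarrow> bool" where
  "unique_weight q \<longleftrightarrow>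
     (\<forall>k l m n. is_path q k m \<and> is_path q l n \<and> cval q m k = cval q n l
        \<longrightarrow> weight q k m = weight q l n)"

text \<open>z is a Galois conjugate of the algebraic number x: a root of the minimal
  polynomial of x over Q (the irreducible rational polynomial vanishing at x).\<close>
definition galois_conjugate :: "complex \<Rightarrow> complex \<Rightarrow> bool" where
  "galois_conjugate x z \<longleftrightarrow>
     (\<exists>p :: rat poly. irreducible p \<and> poly (map_poly of_rat p) x = 0 \<and> poly (map_poly of_rat p) z = 0)"

definition totally_positive :: "complex \<Rightarrow> bool" where
  "totally_positive x \<longleftrightarrow> (\<forall>z. galois_conjugate x z \<longrightarrow> z \<in> \<real> \<and> Re z > 0)"

end

theory Submission
  imports Defs "HOL-Number_Theory.Cong" "HOL-Computational_Algebra.Fundamental_Theorem_Algebra"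
begin

text \<open>
  Clearing denominators turns the numerators and denominators of the continued fraction
  into continuants, integer polynomials in \<open>q\<close>. Both the equality of two values and the equality
  of the (squared) weights are then integer polynomial equations in \<open>q\<close>, so uniqueness of the
  weight only depends on the Galois conjugacy class of \<open>q\<close>.

  With \<open>q = lam\<^sup>2\<close>, rescaled continuants form an orbit of the vector \<open>(1, 0)\<close> under the Hecke group
  (extended by reflections) generated by \<open>(x, y) \<mapsto> (y, x)\<close>, \<open>(x, y) \<mapsto> (x, - y)\<close> and
  \<open>(x, y) \<mapsto> (x + lam * y, y)\<close>, and uniqueness says that this orbit meets the first axis only in
  unit vectors. This holds when \<open>lam \<ge> 2\<close> or \<open>lam = 2 * cos (pi / n)\<close>, by a ping-pong argument:
  up to sign the group is covered by the translates of a monoid of matrices with entries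
  that are \<open>0\<close> or at least \<open>1\<close>.

  A totally positive algebraic integer without conjugate in \<open>[4, \<infinity>)\<close> has all its conjugates in
  \<open>(0, 4)\<close>. By Kronecker's pigeonhole argument it is \<open>2 + 2 * cos (2 * pi * j / n)\<close>, which by the
  irreducibility of cyclotomic polynomials is conjugate to \<open>(2 * cos (pi / n))\<^sup>2\<close>.
\<close>

subsection \<open>The orbit of the first basis vector under the Hecke group\<close>

text \<open>The sequence \<open>s\<close> is \<open>sin (a * \<theta>) / sin \<theta>\<close> for \<open>lam = 2 * cos \<theta>\<close>: the matrix
  \<open>[[lam, - 1], [1, 0]]\<close> has \<open>a\<close>-th power \<open>[[s (a + 1), - s a], [s a, - s (a - 1)]]\<close>.\<close>

locale hecke_sequence =
  fixes lam :: real and s :: "int \<Rightarrow> real"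
  assumes s_0: "s 0 = 0" and s_1: "s 1 = 1"
    and s_rec: "s (a + 1) = lam * s a - s (a - 1)"
    and s_ge_1: "s a \<noteq> 0 \<Longrightarrow> 1 \<le> \<bar>s a\<bar>"
    and s_zero: "s a = 0 \<Longrightarrow> \<bar>s (a + 1)\<bar> = 1"
    and s_sign: "0 \<le> s a * s (a + 1)"
begin

inductive orb :: "real \<Rightarrow> real \<Rightarrow> bool" where
  base: "orb 1 0"
| swap: "orb x y \<Longrightarrow> orb y x"
| refl: "orb x y \<Longrightarrow> orb x (- y)"
| shear: "orb x y \<Longrightarrow> orb (x + lam * y) y"

text \<open>The ping-pong monoid: the generators are, up to sign, the \<open>i\<close>-th power of
  \<open>[[lam, - 1], [1, 0]]\<close> followed by \<open>(x, y) \<mapsto> (y, - x)\<close>, conjugated by \<open>y \<mapsto> - y\<close>.\<close>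

inductive cone :: "real \<Rightarrow> real \<Rightarrow> bool" where
  base: "cone 1 0"
| step: "cone x y \<Longrightarrow> e = 1 \<or> e = - 1 \<Longrightarrow> 0 < e * s i \<Longrightarrow>
    cone (e * (s i * x + s (i - 1) * y)) (e * (s (i + 1) * x + s i * y))"

lemma s_m1: "s (- 1) = - 1"
  using s_rec[of 0] s_0 s_1 by simp

lemma s_prev: "s (a - 1) = lam * s a - s (a + 1)"
  using s_rec[of a] by simp

lemma s_sign': "0 \<le> s a * s (a - 1)"
  using s_sign[of "a - 1"] by (simp add: mult.commute)

text \<open>By \<open>s_sign\<close>, a nonzero neighbour of \<open>s i\<close> shares its sign, and
  \<open>s_ge_1\<close> keeps it away from 0.\<close>

lemma s_pos_ge:
  assumes "e = 1 \<or> e = - 1" "0 < e * s i"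
  shows "1 \<le> e * s i" "e * s (i + 1) = 0 \<or> 1 \<le> e * s (i + 1)"
    "e * s (i - 1) = 0 \<or> 1 \<le> e * s (i - 1)"
proof -
  have *: "e * s j = 0 \<or> 1 \<le> e * s j" if "0 \<le> s i * s j" for j
  proof (cases "s j = 0")
    case False
    then show ?thesis
      using assms that s_ge_1[OF False] by (auto simp: zero_le_mult_iff abs_if split: if_splits)
  qed simp
  from * [of i] assms show "1 \<le> e * s i" by auto
  show "e * s (i + 1) = 0 \<or> 1 \<le> e * s (i + 1)" by (rule *) (rule s_sign)
  show "e * s (i - 1) = 0 \<or> 1 \<le> e * s (i - 1)" by (rule *) (rule s_sign')
qed

text \<open>The generators have entries 0 or at least 1, with diagonal at least 1, so coordinates
  that are at least 1 stay so. Starting from (1, 0), a vanishing \<open>s (i + 1)\<close> forces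
  \<open>e * s i = 1\<close>.\<close>

lemma cone_cases: "cone x y \<Longrightarrow> x = 1 \<and> y = 0 \<or> 1 \<le> x \<and> 1 \<le> y"
proof (induction rule: cone.induct)
  case base
  then show ?case by simp
next
  case (step x y e i)
  note g = s_pos_ge[OF step(2,3)]
  have ge: "0 \<le> e * s (i + 1)" "0 \<le> e * s (i - 1)"
    using g by auto
  show ?case
  proof (cases "x = 1 \<and> y = 0")
    case True
    have "e * s i = 1" if "s (i + 1) = 0"
    proof -
      have "\<bar>s i\<bar> = 1" using s_zero[OF that] s_rec[of "i + 1"] that by simp
      then show ?thesis using step(2,3) by (auto simp: abs_if split: if_splits)
    qed
    then show ?thesis using g True step(2) by auto
  next
    case False
    then have xy: "1 \<le> x" "1 \<le> y" using step.IH by auto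
    have "1 * 1 \<le> (e * s i) * x" "1 * 1 \<le> (e * s i) * y"
      using g(1) xy by (intro mult_mono; simp)+
    moreover have "0 \<le> (e * s (i + 1)) * x" "0 \<le> (e * s (i - 1)) * y"
      using ge xy by simp_all
    ultimately show ?thesis by (simp add: algebra_simps)
  qed
qed

text \<open>A power of \<open>[[lam, - 1], [1, 0]]\<close> applied to a vector \<open>(x, - y)\<close> of the monoid orbit, up to
  the overall sign \<open>e\<close>; the second sign \<open>d\<close> tells whether the result is reflected by \<open>y \<mapsto> - y\<close>.\<close>

definition orb_form :: "real \<Rightarrow> real \<Rightarrow> real \<Rightarrow> bool" where
  "orb_form d p r \<longleftrightarrow> (\<exists>a x y e. (e = 1 \<or> e = - 1) \<and> cone x y \<and>
     p = e * (s (a + 1) * x + s a * y) \<and> r = d * e * (s a * x + s (a - 1) * y))"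

lemma orb_formI:
  assumes "e = 1 \<or> e = - 1" "cone x y" "p = e * (s (a + 1) * x + s a * y)"
    "r = d * e * (s a * x + s (a - 1) * y)"
  shows "orb_form d p r"
  using assms unfolding orb_form_def by blast

text \<open>If \<open>s a\<close> is nonzero, the swapped vector is, up to signs, the generator of
  index \<open>a\<close> applied to \<open>(x, y)\<close>, with new exponent 0. If
  \<open>s a = 0\<close>, the power is plus or minus the identity, and the swap undoes the last
  generator, whose index becomes the new exponent (- 1 for the base vector).\<close>

lemma orb_form_swap:
  assumes "orb_form d p r" and d: "d = 1 \<or> d = - 1"
  shows "orb_form (- d) r p"
proof -
  from assms(1) obtain a x y e where e: "e = 1 \<or> e = - 1" and K: "cone x y"
    and p: "p = e * (s (a + 1) * x + s a * y)" and r: "r = d * e * (s a * x + s (a - 1) * y)"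
    unfolding orb_form_def by blast
  show ?thesis
  proof (cases "s a = 0")
    case False
    define f where "f = sgn (s a)"
    have f: "f = 1 \<or> f = - 1" "0 < f * s a" using False by (auto simp: f_def sgn_if)
    show ?thesis
      by (rule orb_formI[where a = 0 and e = "d * e * f", OF _ cone.step[OF K f]])
        (use e f d in \<open>auto simp: p r s_0 s_1 s_m1\<close>)
  next
    case True
    define t where "t = s (a + 1)"
    have t: "t = 1 \<or> t = - 1" using s_zero[OF True] by (auto simp: t_def abs_if split: if_splits)
    have sa: "s (a - 1) = - t" using s_prev[of a] True by (simp add: t_def)
    have p: "p = e * t * x" and r: "r = - d * e * t * y"
      using p r by (simp_all add: True sa t_def[symmetric])
    from K show ?thesis
    proof (cases rule: cone.cases)
      case base
      show ?thesis
        by (rule orb_formI[where a = "- 1" and e = "d * e * t", OF _ cone.base])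
          (use e t d base in \<open>auto simp: p r s_0 s_1 s_m1\<close>)
    next
      case (step x' y' f i)
      show ?thesis
        by (rule orb_formI[where a = i and e = "- d * e * t * f", OF _ step(3)])
          (use e t d step(4) in \<open>auto simp: p r step(1,2)\<close>)
    qed
  qed
qed

text \<open>The inverse of [[lam, - 1], [1, 0]] sends (p, - r) to - (r, p + lam * r), so the
  exponent drops by one and a swap restores the order.\<close>

lemma orb_form_shear_neg:
  assumes "orb_form (- 1) p r"
  shows "\<exists>d\<in>{1, - 1}. orb_form d (p + lam * r) r"
proof -
  from assms obtain a x y e where e: "e = 1 \<or> e = - 1" and K: "cone x y"
    and p: "p = e * (s (a + 1) * x + s a * y)" and r: "r = - 1 * e * (s a * x + s (a - 1) * y)"
    unfolding orb_form_def by blast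
  have "orb_form 1 r (p + lam * r)"
  proof (rule orb_formI[where a = "a - 1" and e = "- e", OF _ K])
    have "s (a - 1 - 1) = lam * s (a - 1) - s a" using s_prev[of "a - 1"] by simp
    then show "p + lam * r = 1 * - e * (s (a - 1) * x + s (a - 1 - 1) * y)"
      by (simp add: p r s_rec[of a]) (simp add: algebra_simps)
  qed (use e in \<open>auto simp: r\<close>)
  from orb_form_swap[OF this] show ?thesis by simp
qed

text \<open>After a swap, (r, - p) is the image under the power, and [[lam, - 1], [1, 0]] sends it
  to (p + lam * r, r): the exponent rises by one.\<close>

lemma orb_form_shear_pos:
  assumes "orb_form 1 p r"
  shows "\<exists>d\<in>{1, - 1}. orb_form d (p + lam * r) r"
proof -
  from orb_form_swap[OF assms] obtain a x y e where e: "e = 1 \<or> e = - 1" and K: "cone x y"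
    and r: "r = e * (s (a + 1) * x + s a * y)" and p: "p = - 1 * e * (s a * x + s (a - 1) * y)"
    unfolding orb_form_def by auto
  have "orb_form 1 (p + lam * r) r"
  proof (rule orb_formI[where a = "a + 1" and e = e, OF _ K])
    have "s (a + 1 + 1) = lam * s (a + 1) - s a" using s_rec[of "a + 1"] by simp
    then show "p + lam * r = e * (s (a + 1 + 1) * x + s (a + 1) * y)"
      by (simp add: p r s_prev[of a]) (simp add: algebra_simps)
  qed (use e in \<open>simp_all add: r\<close>)
  then show ?thesis by simp
qed

lemma orb_imp_orb_form: "orb p r \<Longrightarrow> \<exists>d\<in>{1, - 1}. orb_form d p r"
proof (induction rule: orb.induct)
  case base
  have "orb_form 1 1 0"
    by (rule orb_formI[where a = 0 and e = 1, OF _ cone.base]) (auto simp: s_0 s_1)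
  then show ?case by auto
next
  case (swap x y)
  then show ?case using orb_form_swap by force
next
  case (refl x y)
  then obtain d where d: "d = 1 \<or> d = - 1" "orb_form d x y" by auto
  have "orb_form (- d) x (- y)" using d(2) unfolding orb_form_def by fastforce
  then show ?case using d(1) by auto
next
  case (shear x y)
  then show ?case using orb_form_shear_pos orb_form_shear_neg by auto
qed

text \<open>If \<open>s a\<close> were nonzero, the second coordinate could not vanish, since
  \<open>s a\<close> and \<open>s (a - 1)\<close> do not have opposite signs and \<open>x\<close> is
  positive. So the power is plus or minus the identity, \<open>y = 0\<close>, and
  \<open>cone_cases\<close> leaves only \<open>x = 1\<close>.\<close>

lemma orb_axis:
  assumes "orb t 0"
  shows "\<bar>t\<bar> = 1"
proof -
  from orb_imp_orb_form[OF assms] obtain d where d: "d = 1 \<or> d = - 1" "orb_form d t 0"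
    by auto
  from d(2) obtain a x y e where e: "e = 1 \<or> e = - 1" and K: "cone x y"
    and t: "t = e * (s (a + 1) * x + s a * y)" and z: "0 = d * e * (s a * x + s (a - 1) * y)"
    unfolding orb_form_def by blast
  have z: "s a * x + s (a - 1) * y = 0" using z d e by auto
  have xy: "1 \<le> x" "0 \<le> y" using cone_cases[OF K] by auto
  have sa: "s a = 0"
  proof (rule ccontr)
    assume ne: "s a \<noteq> 0"
    define f where "f = sgn (s a)"
    have f: "f = 1 \<or> f = - 1" "0 < f * s a" using ne by (auto simp: f_def sgn_if)
    note g = s_pos_ge[OF f]
    have "0 < (f * s a) * x" using f xy by simp
    moreover have "0 \<le> (f * s (a - 1)) * y" using g xy by auto
    moreover have "(f * s a) * x + (f * s (a - 1)) * y = 0"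
      using z by (metis (no_types) distrib_left mult.assoc mult_zero_right)
    ultimately show False by linarith
  qed
  have n: "\<bar>s (a + 1)\<bar> = 1" using s_zero[OF sa] .
  then have "\<bar>s (a - 1)\<bar> = 1" using s_prev[of a] sa by simp
  then have "y = 0" using z sa by auto
  then have "x = 1" using cone_cases[OF K] by auto
  then show ?thesis using t n e \<open>y = 0\<close> by (auto simp: abs_mult)
qed

lemma orb_shear_int: "orb x y \<Longrightarrow> orb (x + lam * of_int m * y) y"
proof (induction m rule: int_induct[where k = 0])
  case base
  then show ?case by simp
next
  case (step1 i)
  from orb.shear[OF step1(2)[OF step1(3)]] show ?case by (simp add: algebra_simps)
next
  case (step2 i)
  \<comment> \<open>Conjugation by the reflection inverts the shear.\<close>
  from orb.refl[OF orb.shear[OF orb.refl[OF step2(2)[OF step2(3)]]]]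
  show ?case by (simp add: algebra_simps)
qed

end

subsection \<open>Continuants\<close>

text \<open>\<open>cont q m k\<close> is \<open>q ^ k\<close> times the product of the values \<open>cval q m j\<close> for \<open>j < k\<close>, see
  \<open>cval_cont\<close> below. It is defined over any ring so that it can also be taken at \<open>[:0, 1:]\<close>.\<close>

fun cont :: "'a::comm_ring_1 \<Rightarrow> (nat \<Rightarrow> int) \<Rightarrow> nat \<Rightarrow> 'a" where
  "cont q m 0 = 1"
| "cont q m (Suc 0) = q * of_int (m 0)"
| "cont q m (Suc (Suc k)) = q * of_int (m (Suc k)) * cont q m (Suc k) + q * cont q m k"

text \<open>Uniqueness with squared weights and cleared denominators: neither square roots nor
  absolute values remain, so the condition makes sense in any commutative ring. Only the last
  continuants have to be nonzero.\<close>

definition cont_unique :: "'a::comm_ring_1 \<Rightarrow> bool" where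
  "cont_unique q \<longleftrightarrow> (\<forall>k l m n. cont q m k \<noteq> 0 \<and> cont q n l \<noteq> 0 \<and>
     cont q m (Suc k) * cont q n l = cont q n (Suc l) * cont q m k \<longrightarrow>
     (cont q m k)\<^sup>2 * q ^ l = (cont q n l)\<^sup>2 * q ^ k)"

section \<open>Rescaled continuants and the Hecke orbit\<close>

context hecke_sequence
begin

text \<open>Dividing by \<open>lam ^ k\<close> turns each recursion step into a swap followed by an
  integer multiple of the shear.\<close>

fun scont :: "(nat \<Rightarrow> int) \<Rightarrow> nat \<Rightarrow> real" where
  "scont m 0 = 1"
| "scont m (Suc 0) = lam * of_int (m 0)"
| "scont m (Suc (Suc k)) = lam * of_int (m (Suc k)) * scont m (Suc k) + scont m k"

lemma cont_scont: "cont (lam\<^sup>2) m k = lam ^ k * scont m k"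
  by (induction m k rule: scont.induct)
    (simp_all add: algebra_simps power2_eq_square)

lemma orb_scont: "orb (scont m (Suc k)) (scont m k)"
proof (induction k)
  case 0
  from orb_shear_int[OF orb.swap[OF orb.base], of "m 0"] show ?case by simp
next
  case (Suc k)
  from orb_shear_int[OF orb.swap[OF Suc], of "m (Suc k)"] show ?case
    by (simp add: algebra_simps)
qed

text \<open>The steps that build the pair from (1, 0) are linear and invertible inside the orbit;
  undoing them takes the multiple by \<open>t\<close> back to (t, 0).\<close>

lemma orb_scont_back:
  "orb (t * scont m (Suc k)) (t * scont m k) \<Longrightarrow> orb t 0"
proof (induction k)
  case 0
  from orb_shear_int[OF 0, of "- m 0"] show ?case by (simp add: algebra_simps orb.swap)
next
  case (Suc k)
  from orb_shear_int[OF Suc.prems, of "- m (Suc k)"]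
  have "orb (t * scont m k) (t * scont m (Suc k))" by (simp add: algebra_simps)
  from Suc.IH[OF orb.swap[OF this]] show ?case .
qed

lemma cont_unique_square:
  assumes lam: "0 < lam"
  shows "cont_unique (lam\<^sup>2)"
  unfolding cont_unique_def
proof (intro allI impI, elim conjE)
  fix k l m n
  assume nz: "cont (lam\<^sup>2) m k \<noteq> 0" "cont (lam\<^sup>2) n l \<noteq> 0"
    and eq: "cont (lam\<^sup>2) m (Suc k) * cont (lam\<^sup>2) n l = cont (lam\<^sup>2) n (Suc l) * cont (lam\<^sup>2) m k"
  have nz: "scont m k \<noteq> 0" "scont n l \<noteq> 0" using nz by (auto simp: cont_scont)
  have eq: "scont m (Suc k) * scont n l = scont n (Suc l) * scont m k"
    using eq lam by (simp add: cont_scont del: scont.simps)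
  \<comment> \<open>Equal values make the pair of \<open>m\<close> equal to \<open>t\<close> times
    the pair of \<open>n\<close>; going back along \<open>n\<close> then puts (t, 0) into the
    orbit.\<close>
  define t where "t = scont m k / scont n l"
  have "orb (t * scont n (Suc l)) (t * scont n l)"
  proof -
    have "t * scont n (Suc l) = scont m (Suc k)" "t * scont n l = scont m k"
      using eq nz by (simp_all add: t_def field_simps del: scont.simps)
    then show ?thesis using orb_scont[of m k] by simp
  qed
  from orb_axis[OF orb_scont_back[OF this]] have "\<bar>scont m k\<bar> = \<bar>scont n l\<bar>"
    using nz by (simp add: t_def divide_simps)
  then have "(scont m k)\<^sup>2 = (scont n l)\<^sup>2" by (metis power2_abs)
  then show "(cont (lam\<^sup>2) m k)\<^sup>2 * (lam\<^sup>2) ^ l = (cont (lam\<^sup>2) n l)\<^sup>2 * (lam\<^sup>2) ^ k"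
    by (simp add: cont_scont power_mult_distrib power_commutes flip: power_mult power_add)
      (simp add: algebra_simps)
qed

end

section \<open>Weights in terms of continuants\<close>

lemma cval_cont:
  assumes "q \<noteq> 0" "is_path q k m"
  shows "cont q m k \<noteq> 0 \<and> cval q m k = cont q m (Suc k) / (q * cont q m k)
    \<and> (\<Prod>j<k. cval q m j) * q ^ k = cont q m k"
  using assms(2)
proof (induction k)
  case 0
  then show ?case using assms(1) by simp
next
  case (Suc k)
  then have IH: "cont q m k \<noteq> 0" "cval q m k = cont q m (Suc k) / (q * cont q m k)"
    "(\<Prod>j<k. cval q m j) * q ^ k = cont q m k" and "cval q m k \<noteq> 0"
    by (auto simp: is_path_def)
  then have nz: "cont q m (Suc k) \<noteq> 0" by auto
  have "(\<Prod>j<Suc k. cval q m j) * q ^ Suc k = ((\<Prod>j<k. cval q m j) * q ^ k) * (cval q m k * q)"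
    by (simp add: mult_ac)
  also have "\<dots> = cont q m (Suc k)" using IH assms(1) by simp
  finally show ?case using nz IH(1) assms(1) by (simp add: IH(2) add_divide_distrib)
qed

lemma weight_cont:
  assumes "0 < q" "is_path q k m"
  shows "(weight q k m)\<^sup>2 * q ^ k = (cont q m k)\<^sup>2"
proof -
  have "(weight q k m)\<^sup>2 = (q powr (real k / 2))\<^sup>2 * (\<Prod>j<k. cval q m j)\<^sup>2"
    by (simp add: weight_def power_mult_distrib flip: abs_prod)
  also have "(q powr (real k / 2))\<^sup>2 = q ^ k"
    using assms(1) by (simp add: powr_powr powr_realpow flip: powr_numeral)
  finally show ?thesis
    using cval_cont[of q k m] assms by (simp add: power2_eq_square mult_ac)
      (metis mult.assoc mult.left_commute)
qed

lemma unique_weight_cont: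
  assumes q: "0 < q" and u: "cont_unique q"
  shows "unique_weight q"
  unfolding unique_weight_def
proof (intro allI impI, elim conjE)
  fix k l m n
  assume p: "is_path q k m" "is_path q l n" and eq: "cval q m k = cval q n l"
  note c = cval_cont[OF _ p(1)] cval_cont[OF _ p(2)]
  have "cont q m (Suc k) * cont q n l = cont q n (Suc l) * cont q m k"
    using c eq q by (simp add: field_simps)
  then have "(cont q m k)\<^sup>2 * q ^ l = (cont q n l)\<^sup>2 * q ^ k"
    using u c q unfolding cont_unique_def by auto
  then have "(weight q k m)\<^sup>2 * (q ^ k * q ^ l) = (weight q l n)\<^sup>2 * (q ^ k * q ^ l)"
    by (simp add: weight_cont[OF q p(1), symmetric] weight_cont[OF q p(2), symmetric] mult_ac)
  then have "(weight q k m)\<^sup>2 = (weight q l n)\<^sup>2" using q by simp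
  moreover have "0 \<le> weight q k m" "0 \<le> weight q l n"
    by (simp_all add: weight_def prod_nonneg)
  ultimately show "weight q k m = weight q l n" by simp
qed

subsection \<open>The values of \<open>q\<close> for which the Hecke group is discrete\<close>

text \<open>For \<open>lam\<close> at least 2 the increments of the sequence do not decrease, so
  from 0, 1 on it grows by at least 1 per step and vanishes only at index 0.\<close>

lemma cont_unique_ge_4:
  assumes "4 \<le> q"
  shows "cont_unique (q::real)"
proof -
  define lam where "lam = sqrt q"
  have lam: "2 \<le> lam" using assms real_le_rsqrt[of 2 q] by (simp add: lam_def)
  define f where "f = rec_nat (0, 1) (\<lambda>_ (x, y). (y, lam * y - x))"
  define g where "g n = fst (f n)" for n
  have snd_f: "snd (f n) = g (Suc n)" for n by (simp add: g_def f_def split: prod.splits)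
  have g0: "g 0 = 0" "g (Suc 0) = 1" by (simp_all add: g_def f_def)
  have g_rec: "g (Suc (Suc n)) = lam * g (Suc n) - g n" for n
    unfolding snd_f[symmetric] by (simp add: g_def f_def split: prod.splits)
  have g_grow: "0 \<le> g n \<and> g n + 1 \<le> g (Suc n)" for n
  proof (induction n)
    case (Suc n)
    then have "2 * g (Suc n) \<le> lam * g (Suc n)" using lam by (intro mult_right_mono) auto
    then show ?case using Suc g_rec[of n] by linarith
  qed (simp add: g0)
  have g_pos: "0 < n \<Longrightarrow> 1 \<le> g n" for n
    using g_grow[of "n - 1"] by (cases n) auto
  \<comment> \<open>The odd extension continues the recurrence through 0.\<close>
  define s where "s a = (if 0 \<le> a then g (nat a) else - g (nat (- a)))" for a :: int
  have s_rec: "s (a + 1) = lam * s a - s (a - 1)" for a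
  proof -
    consider n where "a = int (Suc n)" | "a = 0" | n where "a = - int (Suc n)"
      by (metis int_cases2 not0_implies_Suc of_nat_0 minus_zero)
    then show ?thesis
    proof cases
      case 1
      then have "nat (a + 1) = Suc (Suc n)" "nat a = Suc n" "nat (a - 1) = n" by auto
      then show ?thesis using 1 g_rec[of n] by (simp add: s_def)
    next
      case 2
      then show ?thesis by (simp add: s_def g0)
    next
      case 3
      then have "nat (- (a - 1)) = Suc (Suc n)" "nat (- a) = Suc n" "nat (- (a + 1)) = n" by auto
      then show ?thesis using 3 g_rec[of n]
        by (cases "n = 0") (simp_all add: s_def g0 numeral_2_eq_2)
    qed
  qed
  have "hecke_sequence lam s"
  proof
    show "s 0 = 0" "s 1 = 1" by (simp_all add: s_def g0)
    show "s (a + 1) = lam * s a - s (a - 1)" for a by (rule s_rec)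
    show "s a \<noteq> 0 \<Longrightarrow> 1 \<le> \<bar>s a\<bar>" for a
      using g_pos[of "nat a"] g_pos[of "nat (- a)"] g0 by (cases "a = 0") (auto simp: s_def abs_if)
    show "\<bar>s (a + 1)\<bar> = 1" if "s a = 0" for a
    proof -
      have "a = 0" using that g_pos[of "nat a"] g_pos[of "nat (- a)"]
        by (force simp: s_def split: if_splits)
      then show ?thesis by (simp add: s_def g0)
    qed
    show "0 \<le> s a * s (a + 1)" for a
      using g_grow g0 by (auto simp: s_def zero_le_mult_iff)
  qed
  from hecke_sequence.cont_unique_square[OF this] show ?thesis
    using lam assms by (simp add: lam_def)
qed

text \<open>For the angle pi / n, sin th is the least nonzero value of |sin (a * th)|, which gives
  the gap \<open>s_ge_1\<close>. The sign condition comes from sin being nonnegative on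
  [0, pi].\<close>

lemma cont_unique_cos:
  assumes n: "3 \<le> n"
  shows "cont_unique ((2 * cos (pi / real n))\<^sup>2)"
proof -
  define th where "th = pi / real n"
  have th: "0 < th" "th < pi / 2" "real n * th = pi" using n by (simp_all add: th_def field_simps)
  have sth: "0 < sin th" using th by (simp add: sin_gt_zero)
  define s where "s a = sin (of_int a * th) / sin th" for a
  \<comment> \<open>Since \<open>n * th = pi\<close>, reducing \<open>a\<close> modulo
    \<open>n\<close> changes both sines by the same sign.\<close>
  have red: "\<exists>e r. (e = 1 \<or> e = - 1) \<and> a = int n * (a div int n) + int r \<and> r < n \<and>
     sin (of_int a * th) = e * sin (real r * th) \<and>
     sin (of_int (a + 1) * th) = e * sin (real (Suc r) * th)" for a
  proof -
    define k where "k = a div int n"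
    define r where "r = nat (a mod int n)"
    have r: "r < n" "int r = a mod int n" using n by (simp_all add: r_def nat_less_iff)
    have a: "a = int n * k + int r" by (simp add: r k_def)
    have sin_k: "sin (of_int k * pi) = 0" using sin_zero_iff_int2 by blast
    have sh: "sin (x + of_int k * pi) = cos (of_int k * pi) * sin x" for x
      by (simp add: sin_add sin_k mult.commute)
    have "of_int a * th = real r * th + of_int k * pi"
      "of_int (a + 1) * th = real (Suc r) * th + of_int k * pi"
      by (simp_all add: a algebra_simps flip: th(3))
    moreover have "cos (of_int k * pi) = 1 \<or> cos (of_int k * pi) = - 1"
      using sin_cos_squared_add[of "of_int k * pi"] by (simp add: sin_k power2_eq_1_iff)
    ultimately show ?thesis using r a sh unfolding k_def by metis
  qed
  have sin_ge: "sin th \<le> sin (real r * th)" if "0 < r" "r < n" for r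
  proof (cases "real r * th \<le> pi / 2")
    case True
    have "1 * th \<le> real r * th" using that th by (intro mult_right_mono) auto
    then show ?thesis using True th by (intro sin_monotone_2pi_le) auto
  next
    case False
    \<comment> \<open>Reflection at pi / 2 brings the angle back to where sin is increasing.\<close>
    have "sin th \<le> sin (real (n - r) * th)"
    proof (rule sin_monotone_2pi_le)
      have "1 * th \<le> real (n - r) * th" using that th by (intro mult_right_mono) auto
      then show "th \<le> real (n - r) * th" by simp
    qed (use that th False in \<open>auto simp: of_nat_diff algebra_simps\<close>)
    also have "real (n - r) * th = pi - real r * th"
      using that th by (simp add: of_nat_diff algebra_simps)
    finally show ?thesis by simp
  qed
  have sin_ge0: "0 \<le> sin (real r * th)" if "r \<le> n" for r
    using sin_ge[of r] sth that th(3) by (cases "r = 0"; cases "r = n") auto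
  have "hecke_sequence (2 * cos th) s"
  proof
    show "s 0 = 0" "s 1 = 1" using sth by (simp_all add: s_def)
    show "s (a + 1) = 2 * cos th * s a - s (a - 1)" for a
      using sth by (simp add: s_def field_simps sin_add sin_diff distrib_right left_diff_distrib)
    show "1 \<le> \<bar>s a\<bar>" if "s a \<noteq> 0" for a
    proof -
      obtain e r where e: "e = 1 \<or> e = - 1" "r < n" "sin (of_int a * th) = e * sin (real r * th)"
        using red[of a] by blast
      have "0 < r" using that e by (cases r) (auto simp: s_def)
      then show ?thesis using sin_ge[of r] e sth by (auto simp: s_def)
    qed
    show "\<bar>s (a + 1)\<bar> = 1" if "s a = 0" for a
    proof -
      obtain e r where e: "e = 1 \<or> e = - 1" "r < n" "sin (of_int a * th) = e * sin (real r * th)"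
         "sin (of_int (a + 1) * th) = e * sin (real (Suc r) * th)"
        using red[of a] by blast
      have "r = 0" using that e sin_ge[of r] sth by (cases r) (auto simp: s_def)
      then show ?thesis using e sth by (auto simp: s_def)
    qed
    show "0 \<le> s a * s (a + 1)" for a
    proof -
      obtain e r where e: "e = 1 \<or> e = - 1" "r < n" "sin (of_int a * th) = e * sin (real r * th)"
         "sin (of_int (a + 1) * th) = e * sin (real (Suc r) * th)"
        using red[of a] by blast
      have "e * e = 1" using e by auto
      then have "sin (of_int a * th) * sin (of_int (a + 1) * th) = sin (real r * th) * sin (real (Suc r) * th)"
        unfolding e by (simp add: algebra_simps del: of_nat_Suc) 
      then show ?thesis using sin_ge0[of r] sin_ge0[of "Suc r"] e(2) sth
        by (simp add: s_def del: of_nat_Suc of_int_add)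
    qed
  qed
  from hecke_sequence.cont_unique_square[OF this] show ?thesis
    using th cos_gt_zero[of th] by (simp add: th_def)
qed

subsection \<open>Integer polynomials at ring elements\<close>

abbreviation ipoly :: "int poly \<Rightarrow> 'a::comm_ring_1 \<Rightarrow> 'a" where
  "ipoly p x \<equiv> poly (map_poly of_int p) x"

lemma poly_map_poly_hom:
  fixes h :: "'a::comm_ring_1 \<Rightarrow> 'b::comm_ring_1"
  assumes 0: "h 0 = 0" and add: "\<And>a b. h (a + b) = h a + h b" and mult: "\<And>a b. h (a * b) = h a * h b"
  shows "poly (map_poly h (p + q)) x = poly (map_poly h p) x + poly (map_poly h q) x"
    and "poly (map_poly h (p * q)) x = poly (map_poly h p) x * poly (map_poly h q) x"
proof -
  have *: "poly (map_poly h (p + q)) x = poly (map_poly h p) x + poly (map_poly h q) x" for p q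
    by (induction p q rule: poly_induct2) (simp_all add: map_poly_pCons 0 add algebra_simps)
  have sm: "poly (map_poly h (smult a q)) x = h a * poly (map_poly h q) x" for a
    by (induction q) (simp_all add: map_poly_pCons 0 mult algebra_simps)
  show "poly (map_poly h (p + q)) x = poly (map_poly h p) x + poly (map_poly h q) x" by (rule *)
  show "poly (map_poly h (p * q)) x = poly (map_poly h p) x * poly (map_poly h q) x"
    by (induction p) (simp_all add: map_poly_pCons 0 * sm algebra_simps)
qed

lemma ipoly_simps [simp]:
  fixes x :: "'a::comm_ring_1"
  shows "ipoly (p + q) x = ipoly p x + ipoly q x" "ipoly (p * q) x = ipoly p x * ipoly q x"
    "ipoly (pCons a p) x = of_int a + x * ipoly p x" "ipoly 1 x = 1"
    "ipoly (smult a p) x = of_int a * ipoly p x"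
    "ipoly (- p) x = - ipoly p x" "ipoly (p - q) x = ipoly p x - ipoly q x"
    "ipoly (p ^ n) x = ipoly p x ^ n" "ipoly (of_nat n) x = of_nat n" "ipoly (of_int i) x = of_int i"
proof -
  show add: "ipoly (p + q) x = ipoly p x + ipoly q x" for p q
    by (rule poly_map_poly_hom) simp_all
  show mult: "ipoly (p * q) x = ipoly p x * ipoly q x" for p q
    by (rule poly_map_poly_hom) simp_all
  show pc: "ipoly (pCons a p) x = of_int a + x * ipoly p x" for a p
    by (simp add: map_poly_pCons)
  show one: "ipoly 1 x = 1" using pc[of 1 0] by (simp add: one_pCons)
  show sm: "ipoly (smult a p) x = of_int a * ipoly p x" for a p
    using mult[of "[:a:]" p] pc[of a 0] by simp
  show neg: "ipoly (- p) x = - ipoly p x" for p using sm[of "- 1" p] by simp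
  show "ipoly (p - q) x = ipoly p x - ipoly q x" using add[of p "- q"] neg by simp
  show "ipoly (p ^ n) x = ipoly p x ^ n" by (induction n) (simp_all add: one mult)
  show "ipoly (of_nat n) x = of_nat n" using pc[of "int n" 0] by (simp add: of_nat_poly)
  show "ipoly (of_int i) x = of_int i" using pc[of i 0] by (simp add: of_int_poly)
qed

lemma ipoly_pcompose: "ipoly (p \<circ>\<^sub>p q) x = ipoly p (ipoly q x)"
  by (induction p) (simp_all add: pcompose_pCons)

lemma ipoly_monom: "ipoly (monom 1 n) x = x ^ n"
  by (simp add: map_poly_monom poly_monom)

lemma ipoly_pderiv: "ipoly (pderiv p) x = poly (pderiv (map_poly of_int p)) x"
  by (induction p) (simp_all add: pderiv_pCons map_poly_pCons)

subsection \<open>Minimal polynomials and conjugates\<close>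

text \<open>A polynomial \<open>m\<close> of least degree vanishing at \<open>x\<close> divides
  every other one, in particular \<open>p\<close>; irreducibility makes \<open>p\<close> associated
  to \<open>m\<close>.\<close>

lemma irreducible_dvd_if_common_root:
  fixes x :: "'a::field_char_0"
  assumes p: "irreducible p" "poly (map_poly of_rat p) x = 0"
    and g: "poly (map_poly of_rat g) x = 0"
  shows "p dvd g"
proof -
  let ?e = "\<lambda>p. poly (map_poly of_rat p) x"
  have add: "?e (p + q) = ?e p + ?e q" and mult: "?e (p * q) = ?e p * ?e q" for p q
    by (rule poly_map_poly_hom; simp add: of_rat_add of_rat_mult)+
  define m where "m = arg_min degree (\<lambda>m. m \<noteq> 0 \<and> ?e m = 0)"
  have "p \<noteq> 0 \<and> ?e p = 0" using p by auto
  from arg_min_natI[of "\<lambda>m. m \<noteq> 0 \<and> ?e m = 0", OF this, of degree]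
  have m: "m \<noteq> 0" "?e m = 0" by (auto simp: m_def)
  have min: "degree m \<le> degree q" if "q \<noteq> 0" "?e q = 0" for q
    unfolding m_def using that by (intro arg_min_nat_le) auto
  have dvd: "m dvd q" if "?e q = 0" for q
  proof (rule ccontr)
    assume "\<not> m dvd q"
    then have nz: "q mod m \<noteq> 0" by (simp add: dvd_eq_mod_eq_0)
    have "?e (q div m * m + q mod m) = 0" using that by simp
    then have "?e (q mod m) = 0" unfolding add mult using m by simp
    from min[OF nz this] show False using degree_mod_less[OF m(1), of q] nz by linarith
  qed
  from dvd[OF p(2)] obtain k where k: "p = m * k" by (auto simp: dvd_def)
  have "\<not> is_unit m"
  proof
    assume "is_unit m"
    then obtain c where "m = [:c:]" using m(1) by (metis is_unit_iff_degree degree_0_id)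
    then show False using m by (simp add: map_poly_pCons)
  qed
  then have "is_unit k" using irreducibleD[OF p(1) k] by blast
  then have "p dvd m" using k by simp
  then show ?thesis using dvd[OF g] dvd_trans by blast
qed

lemma galois_conjugate_root:
  assumes "galois_conjugate x z" "ipoly g x = 0"
  shows "ipoly g z = 0"
proof -
  from assms(1) obtain p :: "rat poly" where p: "irreducible p"
    "poly (map_poly of_rat p) x = 0" "poly (map_poly of_rat p) z = 0"
    unfolding galois_conjugate_def by blast
  define h where "h = (map_poly of_int g :: rat poly)"
  have h: "map_poly of_rat h = (map_poly of_int g :: complex poly)"
    by (simp add: h_def map_poly_map_poly o_def)
  from irreducible_dvd_if_common_root[OF p(1,2), of h] assms(2) h obtain k where "h = p * k"
    by (auto simp: dvd_def)
  then have "poly (map_poly of_rat h) z = poly (map_poly of_rat p) z * poly (map_poly of_rat k) z"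
    by (simp only:) (rule poly_map_poly_hom; simp add: of_rat_add of_rat_mult)
  then show ?thesis using p(3) h by simp
qed

lemma galois_conjugate_sym: "galois_conjugate x z \<Longrightarrow> galois_conjugate z x"
  unfolding galois_conjugate_def by blast

lemma prime_factor_root:
  fixes F :: "int poly" and x :: "'a::field_char_0"
  shows "F \<noteq> 0 \<Longrightarrow> ipoly F x = 0 \<Longrightarrow> \<exists>f. prime_elem f \<and> f dvd F \<and> ipoly f x = 0"
proof (induction F rule: prime_divisors_induct)
  case (unit F)
  then obtain G where "1 = F * G" by (auto simp: dvd_def)
  then have "ipoly (F * G) x = 1" using ipoly_simps(4) by metis
  then show ?case using unit by simp
next
  case (factor p F)
  then show ?case by (auto intro: dvd_mult)
qed simp

lemma monic_division:
  fixes f g :: "int poly"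
  assumes "lead_coeff f = 1"
  obtains q r where "g = f * q + r" "r = 0 \<or> degree r < degree f"
proof -
  obtain q r where qr: "pseudo_divmod g f = (q, r)" by force
  have "f \<noteq> 0" using assms by auto
  from pseudo_divmod[OF this qr] assms that show ?thesis by simp
qed

text \<open>A prime factor \<open>f\<close> of a monic \<open>F\<close> plays the role of Gauss's
  lemma: pseudo-division by an annihilator \<open>m\<close> of least degree gives
  \<open>a * f = m * q\<close>, so \<open>f\<close> divides \<open>m\<close> and has least degree
  itself.\<close>

lemma minimal_int_poly:
  fixes x :: "'a::field_char_0"
  assumes "algebraic_int x"
  obtains f where "lead_coeff f = 1" "ipoly f x = 0" "\<And>g. ipoly g x = 0 \<longleftrightarrow> f dvd g"
proof -
  obtain F where F: "ipoly F x = 0" "lead_coeff F = 1"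
    using assms unfolding algebraic_int_altdef_ipoly by blast
  then have "F \<noteq> 0" by auto
  from prime_factor_root[OF this F(1)] obtain f where f: "prime_elem f" "f dvd F" "ipoly f x = 0"
    by blast
  define m where "m = arg_min degree (\<lambda>m. m \<noteq> 0 \<and> ipoly m x = 0)"
  have "f \<noteq> 0 \<and> ipoly f x = 0" using f by auto
  from arg_min_natI[of "\<lambda>m. m \<noteq> 0 \<and> ipoly m x = 0", OF this, of degree]
  have m: "m \<noteq> 0" "ipoly m x = 0" by (auto simp: m_def)
  have min: "degree m \<le> degree g" if "g \<noteq> 0" "ipoly g x = 0" for g
    unfolding m_def using that by (intro arg_min_nat_le) auto
  obtain a q where aq: "a \<noteq> 0" "smult a f = m * q + pseudo_mod f m"
    using pseudo_mod(1)[OF m(1), of f] by blast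
  have "ipoly (pseudo_mod f m) x = ipoly (smult a f - m * q) x" by (simp add: aq)
  also have "\<dots> = 0" using f m by simp
  finally have "pseudo_mod f m = 0" using min pseudo_mod(2)[OF m(1), of f] by force
  then have aq: "a \<noteq> 0" "smult a f = m * q" using aq by simp_all
  have "f dvd m * q" using aq(2) by (metis dvd_refl dvd_smult)
  then have "f dvd m \<or> f dvd q" using f(1) by (simp add: prime_elem_dvd_mult_iff)
  \<comment> \<open>Cancelling \<open>f\<close> would leave \<open>m\<close> as a divisor of the
    nonzero constant \<open>a\<close>, although \<open>m\<close> vanishes at
    \<open>x\<close>.\<close>
  moreover have "\<not> f dvd q"
  proof
    assume "f dvd q"
    then obtain k where "q = f * k" by (auto simp: dvd_def)
    then have "f * [:a:] = f * (m * k)" using aq(2) by (simp add: mult_ac)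
    moreover have "f \<noteq> 0" using f(1) by auto
    ultimately have "[:a:] = m * k" by (metis mult_cancel_left)
    then have "ipoly [:a:] x = 0" using m by (metis ipoly_simps(2) mult_zero_left)
    then show False using aq by simp
  qed
  ultimately have deg: "degree f \<le> degree m" using m(1) dvd_imp_degree_le by blast
  obtain k where k: "F = f * k" using f(2) by (auto simp: dvd_def)
  then have "lead_coeff f * lead_coeff k = 1" using F(2) by (simp add: lead_coeff_mult)
  then have lc: "lead_coeff f = 1 \<or> lead_coeff f = - 1" by (rule pos_zmult_eq_1_iff_lemma)
  define g where "g = smult (lead_coeff f) f"
  have g: "lead_coeff g = 1" "ipoly g x = 0" "degree g = degree f"
    using lc f by (auto simp: g_def)
  have "g dvd h" if h: "ipoly h x = 0" for h
  proof -
    obtain q r where qr: "h = g * q + r" "r = 0 \<or> degree r < degree g"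
      using monic_division[OF g(1)] .
    then have "ipoly r x = 0" using h g by simp
    then have "r = 0" using min[of r] qr(2) deg g(3) by force
    then show ?thesis using qr by simp
  qed
  moreover have "ipoly h x = 0" if "g dvd h" for h using that g by (auto simp: dvd_def)
  ultimately show ?thesis using that[OF g(1,2)] by blast
qed

lemma clear_denominators:
  fixes a :: "rat poly"
  shows "\<exists>c A. c \<noteq> 0 \<and> smult (of_int c) a = map_poly of_int A"
proof (induction a)
  case (pCons r a)
  then obtain c A where cA: "c \<noteq> 0" "smult (of_int c) a = map_poly of_int A" by blast
  obtain n d where nd: "r = of_int n / of_int d" "d \<noteq> 0"
    by (metis Rat_cases Fract_of_int_quotient less_irrefl)
  have "smult (of_int (c * d)) (pCons r a) = map_poly of_int (pCons (c * n) (smult d A))"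
    using nd cA(2) by (simp add: map_poly_pCons map_poly_smult flip: cA(2)) (simp add: mult.commute)
  then show ?case using cA nd by (metis mult_eq_0_iff)
qed (auto intro: exI[of _ 1] exI[of _ 0])

text \<open>Irreducibility over the rationals: a factor vanishing at \<open>x\<close> is, after
  clearing denominators, divisible by \<open>f\<close>, so its cofactor is constant.\<close>

lemma minimal_poly_galois:
  assumes "algebraic_int x"
  obtains f where "lead_coeff f = 1" "ipoly f x = 0" "\<And>g. ipoly g x = 0 \<longleftrightarrow> f dvd g"
    "\<And>z. ipoly f z = 0 \<Longrightarrow> galois_conjugate x z"
proof -
  obtain f where f: "lead_coeff f = 1" "ipoly f x = 0" "\<And>g. ipoly g x = 0 \<longleftrightarrow> f dvd g"
    using minimal_int_poly[OF assms] by blast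
  define P where "P = (map_poly of_int f :: rat poly)"
  have P: "map_poly of_rat P = (map_poly of_int f :: complex poly)"
    by (simp add: P_def map_poly_map_poly o_def)
  have degP: "degree P = degree f" by (simp add: P_def degree_map_poly)
  have f0: "f \<noteq> 0" using f by auto
  then have P0: "P \<noteq> 0" by (simp add: P_def map_poly_eq_0_iff)
  have e_mult: "poly (map_poly of_rat (p * q)) x = poly (map_poly of_rat p) x * poly (map_poly of_rat q) x"
    for p q :: "rat poly"
    by (rule poly_map_poly_hom) (simp_all add: of_rat_add of_rat_mult)
  have unit: "is_unit b" if ab: "P = a * b" and a: "poly (map_poly of_rat a) x = 0" for a b
  proof -
    have nz: "a \<noteq> 0" "b \<noteq> 0" using ab P0 by auto
    obtain c A where cA: "c \<noteq> 0" "smult (of_int c) a = map_poly of_int A"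
      using clear_denominators by blast
    have "ipoly A x = poly (map_poly of_rat (map_poly of_int A)) x"
      by (simp add: map_poly_map_poly o_def)
    also have "\<dots> = 0" using e_mult[of "[:of_int c:]" a] a by (simp flip: cA(2))
    finally have "f dvd A" using f by blast
    moreover have dA: "degree A = degree a"
      using cA by (metis degree_map_poly degree_smult_eq of_int_eq_0_iff)
    moreover have "A \<noteq> 0" using cA nz by auto
    ultimately have "degree f \<le> degree a" using dvd_imp_degree_le by metis
    moreover have "degree P = degree a + degree b" using ab nz by (simp add: degree_mult_eq)
    ultimately have "degree b = 0" using degP by simp
    then show ?thesis using nz by (metis is_unit_iff_degree)
  qed
  have "irreducible P"
  proof (rule irreducibleI)
    show "P \<noteq> 0" by (rule P0)
    show "\<not> is_unit P"
    proof
      assume "is_unit P"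
      then have "degree f = 0" using P0 degP is_unit_iff_degree by metis
      then have "f = [:1:]" using f(1) by (metis degree_0_id)
      then show False using f(2) by simp
    qed
    show "is_unit a \<or> is_unit b" if "P = a * b" for a b
    proof -
      have "poly (map_poly of_rat a) x * poly (map_poly of_rat b) x = 0"
        using f(2) P that e_mult[of a b] by simp
      then show ?thesis using unit[of a b] unit[of b a] that by (auto simp: mult.commute)
    qed
  qed
  then have "galois_conjugate x z" if "ipoly f z = 0" for z
    unfolding galois_conjugate_def using P f(2) that by (intro exI[of _ P]) simp
  then show ?thesis using that f by blast
qed

subsection \<open>Conjugates of roots of unity\<close>

text \<open>The inner binomial coefficients are divisible by \<open>p\<close>.\<close>

lemma prime_dvd_power_sum:
  fixes a b :: "'a::comm_ring_1"
  assumes p: "prime (p::nat)"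
  shows "of_nat p dvd (a + b) ^ p - (a ^ p + b ^ p)"
proof -
  have p0: "0 < p" using p prime_gt_0_nat by blast
  let ?t = "\<lambda>k. of_nat (p choose k) * a ^ k * b ^ (p - k)"
  have "{..p} = insert 0 (insert p {1..<p})" using p0 by auto
  then have "(a + b) ^ p = ?t 0 + (?t p + (\<Sum>k\<in>{1..<p}. ?t k))"
    unfolding binomial_ring using p0 by simp
  then have "(a + b) ^ p - (a ^ p + b ^ p) = (\<Sum>k\<in>{1..<p}. ?t k)"
    by (simp add: algebra_simps)
  moreover have "of_nat p dvd (\<Sum>k\<in>{1..<p}. ?t k)"
  proof (rule dvd_sum)
    fix k assume k: "k \<in> {1..<p}"
    then have "p dvd p choose k" using p by (intro dvd_choose_prime) auto
    then have "(of_nat p :: 'a) dvd of_nat (p choose k)" by (metis dvd_def of_nat_mult)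
    then show "of_nat p dvd ?t k" by (simp add: mult.assoc)
  qed
  ultimately show ?thesis by simp
qed

lemma prime_dvd_power_minus_self:
  assumes p: "prime (p::nat)"
  shows "int p dvd a ^ p - a"
proof (induction a rule: int_induct[where k = 0])
  case base
  then show ?case using prime_gt_0_nat[OF p] by (simp add: zero_power)
next
  case (step1 i)
  from dvd_add[OF prime_dvd_power_sum[OF p, of i 1] step1(2)] show ?case
    by (simp add: algebra_simps)
next
  case (step2 i)
  from dvd_diff[OF step2(2) prime_dvd_power_sum[OF p, of "i - 1" 1]] show ?case
    by (simp add: algebra_simps)
qed

text \<open>Modulo \<open>p\<close>, taking \<open>p\<close>-th powers is additive and fixes the
  integer coefficients, so it acts only on the variable.\<close>

lemma prime_dvd_pcompose_power:
  fixes f :: "int poly"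
  assumes p: "prime (p::nat)"
  shows "of_nat p dvd f \<circ>\<^sub>p monom 1 p - f ^ p"
proof (induction f)
  case 0
  then show ?case using prime_gt_0_nat[OF p] by (simp add: zero_power)
next
  case (pCons a f)
  let ?p = "of_nat p :: int poly"
  have "int p dvd a - a ^ p"
    using prime_dvd_power_minus_self[OF p, of a] by (simp add: dvd_diff_commute)
  then obtain c where "a - a ^ p = int p * c" by (auto simp: dvd_def)
  then have "[:a - a ^ p:] = ?p * [:c:]" by (simp add: of_nat_poly)
  then have 1: "?p dvd [:a - a ^ p:]" by (rule dvdI)
  have 2: "?p dvd monom 1 p * (f \<circ>\<^sub>p monom 1 p - f ^ p)" using pCons(2) by simp
  have 3: "?p dvd ([:a:] + monom 1 1 * f) ^ p - ([:a:] ^ p + (monom 1 1 * f) ^ p)"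
    by (rule prime_dvd_power_sum[OF p])
  have A: "[:a:] = [:a - a ^ p:] + [:a ^ p:]" by simp
  have X: "monom 1 (Suc 0) \<circ>\<^sub>p monom 1 p = (monom 1 p :: int poly)"
    by (simp add: monom_altdef pcompose_pCons)
  have e: "pCons a f = [:a:] + monom 1 1 * f" by (simp add: monom_altdef)
  have "pCons a f \<circ>\<^sub>p monom 1 p - pCons a f ^ p = ([:a - a ^ p:] + monom 1 p * (f \<circ>\<^sub>p monom 1 p - f ^ p))
     - (([:a:] + monom 1 1 * f) ^ p - ([:a:] ^ p + (monom 1 1 * f) ^ p))"
    unfolding e by (simp add: pcompose_add pcompose_mult pcompose_const power_mult_distrib
        monom_power poly_const_pow X) (subst A, simp only: algebra_simps)
  then show ?case using dvd_diff[OF dvd_add[OF 1 2] 3] by simp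
qed

text \<open>Let \<open>f\<close> be the minimal polynomial of \<open>x\<close>, write \<open>X ^ n - 1 = f * k\<close> and \<open>w = x ^ p\<close>. If
  \<open>f w \<noteq> 0\<close>, then differentiating gives \<open>n = f w * k' w * w\<close>, while \<open>f w\<close> is divisible by \<open>p\<close>
  because \<open>f (X ^ p)\<close> and \<open>f ^ p\<close> agree modulo \<open>p\<close>; hence \<open>p\<close> divides \<open>n\<close>.\<close>

lemma root_of_unity_prime_power_conjugate:
  fixes x :: "'a::field_char_0"
  assumes n: "0 < n" "x ^ n = 1" and p: "prime p" "\<not> p dvd n" and g: "ipoly g x = 0"
  shows "ipoly g (x ^ p) = 0"
proof -
  define F where "F = (monom 1 n - 1 :: int poly)"
  have F: "ipoly F y = y ^ n - 1" for y :: 'a by (simp add: F_def ipoly_monom)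
  have "lead_coeff F = 1"
    using n lead_coeff_add_le[of "- 1" "monom (1::int) n"]
    by (simp add: F_def degree_monom_eq)
  then have "algebraic_int x" unfolding algebraic_int_altdef_ipoly using F n by (auto intro!: exI[of _ F])
  then obtain f where f: "lead_coeff f = 1" "ipoly f x = 0" "\<And>g. ipoly g x = 0 \<longleftrightarrow> f dvd g"
    using minimal_int_poly by blast
  have fn0: "degree f > 0"
  proof (rule ccontr)
    assume "\<not> 0 < degree f"
    then have "f = [:1:]" using f(1) by (metis degree_0_id neq0_conv)
    then show False using f(2) by simp
  qed
  obtain k where k: "F = f * k" using f(3)[of F] F n by (auto simp: dvd_def)
  define w where "w = x ^ p"
  have wn: "w ^ n = 1" using n by (simp add: w_def flip: power_mult) (simp add: mult.commute power_mult)
  have "ipoly f w = 0"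
  proof (rule ccontr)
    assume nz: "ipoly f w \<noteq> 0"
    have "ipoly f w * ipoly k w = 0" using F[of w] wn k by simp
    then have kw: "ipoly k w = 0" using nz by simp
    have "pderiv F = f * pderiv k + k * pderiv f" by (simp add: k pderiv_mult)
    moreover have "pderiv F = smult (int n) (monom 1 (n - 1))"
      by (simp add: F_def pderiv_diff pderiv_monom smult_monom)
    ultimately have "ipoly (smult (int n) (monom 1 (n - 1))) w = ipoly (f * pderiv k + k * pderiv f) w"
      by simp
    then have "of_nat n * w ^ (n - 1) = ipoly f w * ipoly (pderiv k) w"
      by (simp add: kw ipoly_monom)
    then have "of_nat n * (w ^ (n - 1) * w) = ipoly f w * ipoly (pderiv k) w * w"
      by (simp add: mult_ac)
    then have nw: "of_nat n = ipoly f w * ipoly (pderiv k) w * w"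
      using wn n by (simp flip: power_Suc2)
    obtain h where h: "f \<circ>\<^sub>p monom 1 p - f ^ p = of_nat p * h"
      using prime_dvd_pcompose_power[OF p(1), of f] by (auto simp: dvd_def)
    have "ipoly (f \<circ>\<^sub>p monom 1 p - f ^ p) x = ipoly f w"
      using f(2) prime_gt_0_nat[OF p(1)] by (simp add: ipoly_pcompose ipoly_monom w_def)
    then have fw: "ipoly f w = of_nat p * ipoly h x" unfolding h by simp
    \<comment> \<open>Now n = p * H(x). The remainder \<open>r\<close> of \<open>H\<close> has
      degree below that of \<open>f\<close>, so n - p * r, which vanishes at \<open>x\<close>, is
      the zero polynomial; its constant term shows that \<open>p\<close> divides
      \<open>n\<close>.\<close>
    define H where "H = h * (pderiv k \<circ>\<^sub>p monom 1 p) * monom 1 p"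
    obtain q r where qr: "H = f * q + r" "r = 0 \<or> degree r < degree f"
      using monic_division[OF f(1)] .
    have "ipoly ([:int n:] - smult (int p) r) x = of_nat n - of_nat p * ipoly H x"
      using f(2) by (simp add: qr)
    also have "\<dots> = 0" unfolding H_def
      by (simp add: nw fw ipoly_pcompose ipoly_monom flip: w_def)
    finally have "f dvd [:int n:] - smult (int p) r" using f(3) by blast
    moreover have "degree ([:int n:] - smult (int p) r) < degree f"
      using qr(2) fn0 by (intro degree_diff_less) auto
    ultimately have "[:int n:] - smult (int p) r = 0" using dvd_imp_degree_le not_le by blast
    then have "coeff ([:int n:] - smult (int p) r) 0 = 0" by simp
    then have "int n = int p * coeff r 0" by simp
    then have "int p dvd int n" by simp
    then show False using p(2) by simp
  qed
  then show ?thesis using f(3)[of g] g by (auto simp: dvd_def w_def)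
qed

text \<open>One prime factor of \<open>k\<close> is removed at a time; none divides
  \<open>n\<close>, and powers of \<open>x\<close> remain \<open>n\<close>-th roots of
  unity.\<close>

lemma root_of_unity_power_conjugate:
  fixes x :: "'a::field_char_0"
  assumes "0 < n" "x ^ n = 1" "coprime k n" "0 < k" "ipoly g x = 0"
  shows "ipoly g (x ^ k) = 0"
  using assms(2-)
proof (induction k arbitrary: x rule: less_induct)
  case (less k)
  show ?case
  proof (cases "k = 1")
    case False
    then obtain p where p: "prime p" "p dvd k" using prime_factor_nat by blast
    then obtain j where j: "k = p * j" by (auto simp: dvd_def)
    have "\<not> p dvd n" using p less.prems(2) by (metis coprime_common_divisor not_prime_unit)
    then have 1: "ipoly g (x ^ p) = 0"
      using root_of_unity_prime_power_conjugate[OF assms(1) less.prems(1) p(1)] less.prems by blast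
    have "j < k" using j less.prems(3) prime_gt_1_nat[OF p(1)] by simp
    moreover have "(x ^ p) ^ n = 1" using less.prems(1) by (metis mult.commute power_mult power_one)
    ultimately have "ipoly g ((x ^ p) ^ j) = 0"
      using less.IH[of j "x ^ p"] less.prems j 1 by simp
    then show ?thesis by (simp add: j power_mult)
  qed (use less in simp)
qed

subsection \<open>Kronecker's theorem for conjugates in (0, 4)\<close>

text \<open>Dickson polynomials with parameter 1 in the variable shifted by 2: at u + 1 / u + 2 the
  value is u^k + 1 / u^k.\<close>

fun dickson :: "nat \<Rightarrow> int poly" where
  "dickson 0 = [:2:]"
| "dickson (Suc 0) = [:- 2, 1:]"
| "dickson (Suc (Suc k)) = [:- 2, 1:] * dickson (Suc k) - dickson k"

lemma ipoly_dickson: "ipoly (dickson k) (complex_of_real (2 + 2 * cos t)) = of_real (2 * cos (real k * t))"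
proof (induction k rule: dickson.induct)
  case (3 k)
  have "cos (real (Suc (Suc k)) * t) = 2 * cos t * cos (real (Suc k) * t) - cos (real k * t)"
  proof -
    have "real (Suc (Suc k)) * t = real (Suc k) * t + t" "real k * t = real (Suc k) * t - t"
      by (simp_all add: algebra_simps)
    then show ?thesis by (simp only: cos_add cos_diff) (simp add: algebra_simps)
  qed
  then have *: "2 * cos (real (Suc (Suc k)) * t) = (2 * cos t) * (2 * cos (real (Suc k) * t)) - 2 * cos (real k * t)"
    by simp
  show ?case
    unfolding * dickson.simps ipoly_simps 3 by simp
qed simp_all

text \<open>By Lagrange interpolation the coefficients are linear combinations of the values on
  \<open>R\<close>, with factors depending on \<open>R\<close> alone.\<close>

lemma coeff_bound_of_values:
  fixes R :: "'a::real_normed_field set"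
  assumes "finite R"
  shows "\<exists>C. \<forall>r. degree r < card R \<and> (\<forall>z\<in>R. norm (poly r z) \<le> B) \<longrightarrow> (\<forall>i. norm (coeff r i) \<le> C)"
proof -
  define L where "L z = (\<Prod>y\<in>R - {z}. smult (inverse (z - y)) [:- y, 1:])" for z
  define C where "C = (\<Sum>z\<in>R. \<bar>B\<bar> * (\<Sum>i\<le>card R. norm (coeff (L z) i)))"
  have degL: "degree (L z) < card R" if "z \<in> R" for z
  proof -
    have "degree (L z) \<le> (\<Sum>y\<in>R - {z}. 1)"
      unfolding L_def by (rule order.trans[OF degree_prod_sum_le sum_mono])
        (use assms in \<open>auto intro: order.trans[OF degree_smult_le]\<close>)
    also have "\<dots> < card R" using that assms by (simp add: card_gt_0_iff) (metis card_gt_0_iff diff_less empty_iff zero_less_Suc)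
    finally show ?thesis .
  qed
  have poly_L: "poly (L z) y = (if y = z then 1 else 0)" if "z \<in> R" "y \<in> R" for z y
    using that assms
  proof (cases "y = z")
    case True
    have "inverse (z - u) * (z - u) = 1" if "u \<in> R - {z}" for u
      using that by (intro left_inverse) auto
    then have "(\<Prod>u\<in>R - {z}. inverse (z - u) * (z - u)) = 1" by (rule prod.neutral[OF ballI])
    moreover have "poly (L z) z = (\<Prod>u\<in>R - {z}. inverse (z - u) * (z - u))"
      unfolding L_def poly_prod by (rule prod.cong) (simp_all add: algebra_simps)
    ultimately show ?thesis using True by simp
  next
    case False
    then show ?thesis using that assms by (auto simp: L_def poly_prod prod_zero_iff)
  qed
  have "norm (coeff r i) \<le> C" if r: "degree r < card R" "\<forall>z\<in>R. norm (poly r z) \<le> B" for r i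
  proof -
    define s where "s = (\<Sum>z\<in>R. smult (poly r z) (L z))"
    have "r = s"
    proof (rule poly_eqI_degree)
      show "poly r y = poly s y" if "y \<in> R" for y
        using that assms by (simp add: s_def poly_sum poly_L if_distrib cong: if_cong)
      show "degree s < card R"
        unfolding s_def using r(1) degL by (intro degree_sum_less)
          (auto intro: le_less_trans[OF degree_smult_le])
    qed (rule r)
    show ?thesis
    proof (cases "i \<le> card R")
      case True
      have "norm (coeff r i) \<le> (\<Sum>z\<in>R. norm (poly r z) * norm (coeff (L z) i))"
        by (subst \<open>r = s\<close>) (simp add: s_def coeff_sum norm_mult sum_norm_le)
      also have "\<dots> \<le> C"
        unfolding C_def
      proof (intro sum_mono mult_mono)
        show "norm (coeff (L z) i) \<le> (\<Sum>i\<le>card R. norm (coeff (L z) i))" for z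
          using True by (intro member_le_sum) auto
      qed (use r in \<open>auto intro: order.trans sum_nonneg\<close>)
      finally show ?thesis .
    next
      case False
      then have "coeff r i = 0" using r(1) by (intro coeff_eq_0) simp
      then show ?thesis by (auto simp: C_def intro!: sum_nonneg mult_nonneg_nonneg)
    qed
  qed
  then show ?thesis by blast
qed

lemma finite_int_poly_bounded_coeffs:
  "finite {r :: int poly. degree r \<le> d \<and> (\<forall>i. \<bar>coeff r i\<bar> \<le> C)}"
proof (rule finite_subset)
  show "finite (Poly ` {xs. set xs \<subseteq> {- C..C} \<and> length xs \<le> Suc d})"
    by (intro finite_imageI finite_lists_length_le) simp
  show "{r. degree r \<le> d \<and> (\<forall>i. \<bar>coeff r i\<bar> \<le> C)} \<subseteq> Poly ` {xs. set xs \<subseteq> {- C..C} \<and> length xs \<le> Suc d}"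
  proof clarify
    fix r :: "int poly"
    assume r: "degree r \<le> d" "\<forall>i. \<bar>coeff r i\<bar> \<le> C"
    have "set (coeffs r) \<subseteq> range (coeff r)" by (auto simp: coeffs_def)
    moreover have "coeff r i \<in> {- C..C}" for i using r(2)[rule_format, of i] by auto
    ultimately have "set (coeffs r) \<subseteq> {- C..C}" by blast
    moreover have "length (coeffs r) \<le> Suc d" using r(1) by (cases "r = 0") (simp_all add: length_coeffs)
    ultimately show "r \<in> Poly ` {xs. set xs \<subseteq> {- C..C} \<and> length xs \<le> Suc d}"
      by (intro image_eqI[of _ _ "coeffs r"]) auto
  qed
qed

text \<open>The remainders of the Dickson polynomials modulo the minimal polynomial of \<open>x\<close> take values
  of modulus at most 2 at all conjugates, so by interpolation there are finitely many of
  them and two of them coincide.\<close>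

lemma kronecker_cos:
  assumes alg: "algebraic_int x"
    and conj: "\<And>z. galois_conjugate x z \<Longrightarrow> z \<in> \<real> \<and> 0 < Re z \<and> Re z < 4"
  obtains j :: int and n :: nat where "0 < n" "x = of_real (2 + 2 * cos (2 * pi * of_int j / of_nat n))"
proof -
  obtain f where f: "lead_coeff f = 1" "ipoly f x = 0" "\<And>g. ipoly g x = 0 \<longleftrightarrow> f dvd g"
    and fconj: "\<And>z. ipoly f z = 0 \<Longrightarrow> galois_conjugate x z"
    using minimal_poly_galois[OF alg] by blast
  define F where "F = (map_poly of_int f :: complex poly)"
  have f0: "f \<noteq> 0" using f(1) by auto
  have degF: "degree F = degree f" by (simp add: F_def degree_map_poly)
  have F0: "F \<noteq> 0" using f0 by (simp add: F_def map_poly_eq_0_iff)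
  have fn0: "degree f > 0"
  proof (rule ccontr)
    assume "\<not> 0 < degree f"
    then have "f = [:1:]" using f(1) by (metis degree_0_id neq0_conv)
    then show False using f(2) by simp
  qed
  define R where "R = {z. poly F z = 0}"
  have finR: "finite R" unfolding R_def by (rule poly_roots_finite[OF F0])
  \<comment> \<open>Simple roots make the number of conjugates equal to the degree, as interpolation
    needs. At a double root \<open>pderiv f\<close> would vanish, hence also at its conjugate
    \<open>x\<close>, against minimality.\<close>
  have "rsquarefree F"
    unfolding rsquarefree_roots
  proof (intro allI notI, elim conjE)
    fix a assume a: "poly F a = 0" "poly (pderiv F) a = 0"
    have "galois_conjugate a x" using fconj a(1) galois_conjugate_sym by (simp add: F_def)
    moreover have "ipoly (pderiv f) a = 0" using a(2) by (simp add: F_def ipoly_pderiv)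
    ultimately have "ipoly (pderiv f) x = 0" by (rule galois_conjugate_root)
    then have "f dvd pderiv f" using f(3) by blast
    moreover have "pderiv f \<noteq> 0" using fn0 by (simp add: pderiv_eq_0_iff)
    ultimately have "degree f \<le> degree (pderiv f)" by (rule dvd_imp_degree_le)
    then show False using fn0 by (simp add: degree_pderiv)
  qed
  from complex_poly_decompose_rsquarefree[OF this]
  have "degree (smult (lead_coeff F) (\<Prod>z\<in>R. [:- z, 1:])) = degree f" by (simp add: R_def degF)
  then have card: "card R = degree f"
    using F0 finR by (simp add: degree_prod_sum_eq)
  have "\<exists>q r. dickson k = f * q + r \<and> (r = 0 \<or> degree r < degree f)" for k
    using monic_division[OF f(1)] by metis
  then obtain q r where qr: "\<And>k. dickson k = f * q k + r k" "\<And>k. r k = 0 \<or> degree (r k) < degree f"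
    by metis
  have deg: "degree (r k) < degree f" for k using qr(2)[of k] fn0 by auto
  have root: "\<exists>t. z = of_real (2 + 2 * cos t)" if z: "galois_conjugate x z" for z
  proof -
    have "cos (arccos (Re z / 2 - 1)) = Re z / 2 - 1"
      using conj[OF z] by (intro cos_arccos) auto
    then have "Re z = 2 + 2 * cos (arccos (Re z / 2 - 1))" by simp
    then show ?thesis using conj[OF z] by (metis of_real_Re)
  qed
  have bound: "norm (poly (map_poly of_int (r k)) z) \<le> 2" if "z \<in> R" for k z
  proof -
    have z: "ipoly f z = 0" using that by (simp add: R_def F_def)
    then obtain t where t: "z = of_real (2 + 2 * cos t)" using root fconj by blast
    have "ipoly (r k) z = ipoly (dickson k) z" using z by (simp add: qr(1))
    also have "\<dots> = of_real (2 * cos (real k * t))" unfolding t by (rule ipoly_dickson)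
    finally show ?thesis by (simp add: norm_mult)
  qed
  from coeff_bound_of_values[OF finR, of 2] obtain C where
    C: "\<And>r i. degree r < card R \<Longrightarrow> \<forall>z\<in>R. norm (poly r z) \<le> 2 \<Longrightarrow> norm (coeff r i) \<le> C" by blast
  have "\<bar>coeff (r k) i\<bar> \<le> \<lceil>C\<rceil>" for k i
  proof -
    have "norm (coeff (map_poly of_int (r k) :: complex poly) i) \<le> C"
      using bound deg card by (intro C) (auto simp: degree_map_poly)
    then show ?thesis by (simp add: coeff_map_poly) linarith
  qed
  then have "range r \<subseteq> {r. degree r \<le> degree f \<and> (\<forall>i. \<bar>coeff r i\<bar> \<le> \<lceil>C\<rceil>)}"
    using deg by (auto intro: less_imp_le)
  then have "finite (range r)" using finite_int_poly_bounded_coeffs finite_subset by blast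
  then have "\<not> inj r" using finite_imageD[of r UNIV] by auto
  then obtain k l where kl: "k < l" "r k = r l" unfolding inj_def by (metis linorder_neqE_nat)
  have "galois_conjugate x x" using fconj f(2) by blast
  then obtain t where t: "x = of_real (2 + 2 * cos t)" using root by blast
  have "ipoly (dickson k) x = ipoly (dickson l) x" using f(2) kl(2) by (simp add: qr(1))
  then have "cos (real l * t) = cos (real k * t)"
    unfolding t ipoly_dickson by (simp only: of_real_eq_iff)
  then obtain j where j: "real l * t = real k * t + 2 * of_int j * pi \<or> real l * t = - (real k * t) + 2 * of_int j * pi"
    unfolding cos_eq Ints_def by blast
  then have "real (l - k) * t = 2 * pi * of_int j \<or> real (l + k) * t = 2 * pi * of_int j"
    using kl(1) by (auto simp: of_nat_diff algebra_simps)
  then obtain N :: nat where N: "0 < N" "real N * t = 2 * pi * of_int j"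
    using kl(1) by (metis add_gr_0 zero_less_diff not_gr_zero not_less_zero)
  then have "t = 2 * pi * of_int j / of_nat N" by (simp add: field_simps)
  then show ?thesis using that[OF N(1), of j] t by simp
qed

text \<open>With j / n = i / m in lowest terms, \<open>x\<close> is a polynomial in the primitive
  root of unity \<open>w i\<close>; raising to the inverse \<open>k\<close> of \<open>i\<close>
  modulo \<open>m\<close> leads to \<open>w 1\<close>.\<close>

lemma cos_root_of_unity_conjugate:
  fixes j :: int
  assumes n: "0 < n" and x: "x = complex_of_real (2 + 2 * cos (2 * pi * of_int j / of_nat n))"
  obtains m where "0 < m" "\<And>g. ipoly g x = 0 \<Longrightarrow> ipoly g (complex_of_real (2 + 2 * cos (2 * pi / of_nat m))) = 0"
proof -
  define d where "d = gcd j (int n)"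
  define m where "m = nat (int n div d)"
  define i where "i = j div d"
  have d: "0 < d" "d dvd j" "d dvd int n" using n by (simp_all add: d_def)
  have m0: "0 < m" using n d by (simp add: m_def pos_imp_zdiv_pos_iff zdvd_imp_le)
  have im: "int m = int n div d" using n d by (simp add: m_def pos_imp_zdiv_nonneg_iff)
  have cop: "coprime i (int m)" unfolding im i_def d_def using n by (intro div_gcd_coprime) simp
  have jn: "j = d * i" "int n = d * int m" using d by (simp_all add: i_def im)
  have "of_int j / of_nat n = (of_int i / of_nat m :: real)"
  proof -
    have "real n = of_int d * real m" using jn(2) by (metis of_int_mult of_int_of_nat_eq)
    then show ?thesis using d(1) jn(1) by simp
  qed
  then have x: "x = of_real (2 + 2 * cos (2 * pi * of_int i / of_nat m))"
    using x by (simp add: mult.assoc flip: times_divide_eq_right)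
  define w where "w a = cis (2 * pi * of_int a / of_nat m)" for a :: int
  have w_pow: "w a ^ k = w (a * int k)" for a k
  proof -
    have "w a ^ k = cis (real k * (2 * pi * of_int a / of_nat m))"
      unfolding w_def by (rule Complex.DeMoivre)
    also have "real k * (2 * pi * of_int a / of_nat m) = 2 * pi * of_int (a * int k) / of_nat m"
      by simp
    finally show ?thesis unfolding w_def .
  qed
  have w_m: "w (a * int m) = 1" for a
    using m0 cis_multiple_2pi[of "of_int a"] by (simp add: w_def mult.assoc)
  have w_add: "w (a + b) = w a * w b" for a b
    by (simp add: w_def cis_mult add_divide_distrib distrib_left)
  have w_cong: "w a = w b" if ab: "[a = b] (mod int m)" for a b
  proof -
    obtain c where "a - b = int m * c" using ab by (auto simp: cong_iff_dvd_diff dvd_def)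
    then have "a = b + c * int m" by (simp add: algebra_simps)
    then show ?thesis by (simp add: w_add w_m)
  qed
  have val: "w a + w a ^ (m - 1) + 2 = of_real (2 + 2 * cos (2 * pi * of_int a / of_nat m))" for a
  proof -
    have "w a * w a ^ (m - 1) = 1"
      using power_Suc[of "w a" "m - 1"] m0 w_m[of a] by (simp add: w_pow)
    then have "w a ^ (m - 1) = inverse (w a)" by (rule inverse_unique[symmetric])
    also have "\<dots> = cnj (w a)" by (simp add: w_def cis_cnj)
    finally show ?thesis by (simp add: complex_eq_iff w_def)
  qed
  obtain b where b: "[i * b = 1] (mod int m)" using cong_solve_coprime_int[OF cop] by blast
  \<comment> \<open>Adding \<open>m\<close> keeps \<open>k\<close> positive even for
    \<open>m = 1\<close>.\<close>
  define k where "k = nat (b mod int m) + m"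
  have kb: "[int k = b] (mod int m)" using m0 by (simp add: k_def cong_def)
  then have ik: "[i * int k = 1] (mod int m)" using b cong_scalar_left cong_trans by blast
  have "coprime (int k) (int m)"
    unfolding coprime_iff_invertible_int using ik by (auto simp: mult.commute)
  then have cop_k: "coprime k m" by simp
  have wk: "w i ^ k = w 1" using w_cong[OF ik] by (simp add: w_pow)
  have "ipoly g (complex_of_real (2 + 2 * cos (2 * pi / of_nat m))) = 0" if g: "ipoly g x = 0" for g
  proof -
    \<comment> \<open>The power \<open>m - 1\<close> replaces the inverse of the root of unity, so
      that \<open>G\<close> is a polynomial.\<close>
    define G where "G = g \<circ>\<^sub>p (monom 1 1 + monom 1 (m - 1) + [:2:])"
    have G: "ipoly G (w a) = ipoly g (of_real (2 + 2 * cos (2 * pi * of_int a / of_nat m)))" for a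
      by (simp only: val[symmetric]) (simp add: G_def ipoly_pcompose ipoly_monom)
    have "ipoly G (w i) = 0" using G[of i] g x by simp
    then have "ipoly G (w i ^ k) = 0"
    proof (rule root_of_unity_power_conjugate[OF m0 _ cop_k, rotated 2])
      show "0 < k" using m0 by (simp add: k_def)
      show "w i ^ m = 1" by (simp add: w_pow w_m)
    qed
    then show ?thesis using G[of 1] by (simp add: wk)
  qed
  then show ?thesis using that m0 by blast
qed

lemma totally_positive_conjugate:
  assumes "algebraic_int x" "totally_positive x"
  shows "(\<exists>z. galois_conjugate x z \<and> z \<in> \<real> \<and> 4 \<le> Re z) \<or>
    (\<exists>n\<ge>3. galois_conjugate x (of_real ((2 * cos (pi / real n))\<^sup>2)))"
proof (cases "\<exists>z. galois_conjugate x z \<and> z \<in> \<real> \<and> 4 \<le> Re z")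
  case False
  then have conj: "z \<in> \<real> \<and> 0 < Re z \<and> Re z < 4" if "galois_conjugate x z" for z
    using assms(2) that unfolding totally_positive_def by (meson not_le)
  obtain j n where jn: "0 < n" "x = of_real (2 + 2 * cos (2 * pi * of_int j / of_nat n))"
    using kronecker_cos[OF assms(1) conj] by blast
  obtain m where m: "0 < m" "\<And>g. ipoly g x = 0 \<Longrightarrow> ipoly g (complex_of_real (2 + 2 * cos (2 * pi / of_nat m))) = 0"
    using cos_root_of_unity_conjugate[OF jn] by blast
  define z where "z = complex_of_real (2 + 2 * cos (2 * pi / of_nat m))"
  have z: "galois_conjugate x z" using minimal_poly_galois[OF assms(1)] m(2) z_def by metis
  \<comment> \<open>These would give the values 4 and 0, outside the open interval.\<close>
  have "m \<noteq> 1" "m \<noteq> 2" using conj[OF z] by (auto simp: z_def)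
  then have "3 \<le> m" using m(1) by simp
  moreover have "z = of_real ((2 * cos (pi / real m))\<^sup>2)"
    using cos_double_cos[of "pi / real m"] by (simp add: z_def power_mult_distrib)
  ultimately show ?thesis using z by blast
qed blast

subsection \<open>Transfer to conjugates\<close>

lemma ipoly_cont: "ipoly (cont [:0, 1:] m k) x = cont x m k"
  by (induction x m k rule: cont.induct) (simp_all add: algebra_simps)

lemma cont_of_real: "cont (of_real q :: complex) m k = of_real (cont q m k)"
  by (induction q m k rule: cont.induct) simp_all

lemma cont_unique_of_real: "cont_unique (of_real q :: complex) \<longleftrightarrow> cont_unique q"
  unfolding cont_unique_def cont_of_real
  by (simp only: of_real_eq_iff of_real_eq_0_iff flip: of_real_mult of_real_power)

text \<open>Each hypothesis and the conclusion say whether some integer polynomial vanishes, and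
  conjugates are roots of the same integer polynomials.\<close>

lemma cont_unique_conjugate:
  assumes conj: "galois_conjugate x z" and z: "cont_unique z"
  shows "cont_unique x"
  unfolding cont_unique_def
proof (intro allI impI, elim conjE)
  fix k l m n
  let ?c = "cont [:0, 1:] :: (nat \<Rightarrow> int) \<Rightarrow> nat \<Rightarrow> int poly"
  let ?X = "[:0, 1:] :: int poly"
  have iff: "ipoly g x = 0 \<longleftrightarrow> ipoly g z = 0" for g
    using galois_conjugate_root conj galois_conjugate_sym by blast
  assume "cont x m k \<noteq> 0" "cont x n l \<noteq> 0"
    and eq: "cont x m (Suc k) * cont x n l = cont x n (Suc l) * cont x m k"
  then have "cont z m k \<noteq> 0" "cont z n l \<noteq> 0"
    using iff[of "?c m k"] iff[of "?c n l"] by (simp_all add: ipoly_cont)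
  moreover have "cont z m (Suc k) * cont z n l = cont z n (Suc l) * cont z m k"
    using iff[of "?c m (Suc k) * ?c n l - ?c n (Suc l) * ?c m k"] eq
    by (simp add: ipoly_cont del: cont.simps)
  ultimately have "(cont z m k)\<^sup>2 * z ^ l = (cont z n l)\<^sup>2 * z ^ k"
    using z unfolding cont_unique_def by blast
  then show "(cont x m k)\<^sup>2 * x ^ l = (cont x n l)\<^sup>2 * x ^ k"
    using iff[of "(?c m k)\<^sup>2 * ?X ^ l - (?c n l)\<^sup>2 * ?X ^ k"] by (simp add: ipoly_cont)
qed

theorem theorem3:
  fixes q :: real
  assumes "q > 0" and "algebraic q"
    and "(\<exists>z. galois_conjugate (complex_of_real q) z \<and> z \<in> \<real> \<and> Re z \<ge> 4)
         \<or> (algebraic_int q \<and> totally_positive (complex_of_real q))"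
  shows "unique_weight q"
proof -
  let ?q = "complex_of_real q"
  \<comment> \<open>Used for case (i) and again in case (ii) when some conjugate is at least
    4.\<close>
  have ge_4: "cont_unique ?q" if "galois_conjugate ?q z" "z \<in> \<real>" "4 \<le> Re z" for z
  proof (rule cont_unique_conjugate[OF that(1)])
    show "cont_unique z"
      using cont_unique_ge_4[OF that(3)] that(2) by (metis cont_unique_of_real of_real_Re)
  qed
  have "cont_unique ?q"
    using assms(3)
  proof
    assume "algebraic_int q \<and> totally_positive ?q"
    then have "algebraic_int ?q" "totally_positive ?q" by simp_all
    from totally_positive_conjugate[OF this] show ?thesis
    proof
      assume "\<exists>n\<ge>3. galois_conjugate ?q (of_real ((2 * cos (pi / real n))\<^sup>2))"
      then obtain n where n: "3 \<le> n" "galois_conjugate ?q (of_real ((2 * cos (pi / real n))\<^sup>2))"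
        by blast
      show ?thesis
        by (rule cont_unique_conjugate[OF n(2)])
          (rule cont_unique_of_real[THEN iffD2, OF cont_unique_cos[OF n(1)]])
    qed (use ge_4 in blast)
  qed (use ge_4 in blast)
  then have "cont_unique q" by (rule cont_unique_of_real[THEN iffD1])
  then show ?thesis by (rule unique_weight_cont[OF assms(1)])
qed

end
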